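(* Let $n,m,N\in\mathbb{N}$ and $B_1,\ldots,B_N\in\mathbb{R}^{n\times m}$. Consider the uncertain system $\dot{\sigma}=Bu$, where $\sigma\in\mathbb{R}^n$ is the state, $u\in\mathbb{R}^m$ is the input, and $B$ is a constant but unknown matrix in the convex hull $\mathrm{co}\{B_1,\ldots,B_N\}$, together with the unit vector controller $u=K\,\sigma/\|\sigma\|$, $K\in\mathbb{R}^{m\times n}$. Let $\mu>0$ be given. Suppose there exist symmetric matrices $X\in\mathbb{R}^{n\times n}$ and $R\in\mathbb{R}^{n\times n}$, and a full matrix $Z\in\mathbb{R}^{m\times n}$, such that $$X>0,\qquad R>0,$$ $$\begin{bmatrix} B_iZ+Z^\top B_i^\top+\dfrac{\mu}{4}I+R & Z^\top B_i^\top\\ B_iZ & -\mu I\end{bmatrix}<0\qquad\text{for all } i\in\{1,\ldots,N\}.$$ Then, with $K=ZX^{-1}$, for every $B\in\mathrm{co}\{B_1,\ldots,B_N\}$ the origin of the closed-loop system $$\dot{\sigma}=BK\,\frac{\sigma}{\|\sigma\|}$$ is globally asymptotically stable.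
   Context: The convex hull is $\mathrm{co}\{B_1,\ldots,B_N\}=\{\sum_{i=1}^N\alpha_iB_i:\alpha_i\ge 0,\ \sum_{i=1}^N\alpha_i=1\}$; the uncertain parameter vector $\alpha$ is constant in time. $\|\cdot\|$ is the Euclidean norm and $I$ is the $n\times n$ identity matrix. For a symmetric matrix $M$, $M>0$ (respectively $M<0$) means that $M$ is positive (respectively negative) definite. "Full matrix" means that no structure (such as symmetry) is imposed on $Z$. Since the right-hand side of the closed-loop system is discontinuous at $\sigma=0$, its solutions are understood in the sense of Filippov, i.e. absolutely continuous functions $\sigma(t)$ satisfying for almost every $t$ the differential inclusion $\dot\sigma(t)\in F(\sigma(t))$, where $F(\sigma)=\{BK\sigma/\|\sigma\|\}$ for $\sigma\neq 0$ and $F(0)=\{BKv: v\in\mathbb{R}^n,\ \|v\|\le 1\}$. Global asymptotic stability of the origin (Lyapunov stability and convergence to the origin from every initial condition) refers to all such solutions. *)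

theory Defs
  imports "HOL-Analysis.Analysis"
begin

(* Symmetry is not part of these two predicates; it is stated separately where it is needed. *)
definition pos_def :: "real^'n^'n \<Rightarrow> bool" where
  "pos_def M \<longleftrightarrow> (\<forall>x. x \<noteq> 0 \<longrightarrow> x \<bullet> (M *v x) > 0)"

definition neg_def :: "real^'n^'n \<Rightarrow> bool" where
  "neg_def M \<longleftrightarrow> (\<forall>x. x \<noteq> 0 \<longrightarrow> x \<bullet> (M *v x) < 0)"

(* The matrix with block rows (P, Q) and (R, S), indexed by sum types. *)
definition block_mat ::
    "'a^'c^'r \<Rightarrow> 'a^'d^'r \<Rightarrow> 'a^'c^'s \<Rightarrow> 'a^'d^'s \<Rightarrow> 'a^('c + 'd)^('r + 's)" where
  "block_mat P Q R S = (\<chi> i j.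
     case i of
       Inl a \<Rightarrow> (case j of Inl c \<Rightarrow> P $ a $ c | Inr d \<Rightarrow> Q $ a $ d)
     | Inr b \<Rightarrow> (case j of Inl c \<Rightarrow> R $ b $ c | Inr d \<Rightarrow> S $ b $ d))"

(* The usual epsilon-delta definition.  A division D of its own union is a finite family of
   non-overlapping compact intervals, and each k in D is the interval from Inf k to Sup k.
   (The library's absolutely_continuous is about measures.) *)
definition absolutely_continuous_on :: "real set \<Rightarrow> (real \<Rightarrow> 'a::real_normed_vector) \<Rightarrow> bool" where
  "absolutely_continuous_on I f \<longleftrightarrow>
     (\<forall>\<epsilon>>0. \<exists>\<delta>>0. \<forall>D. D division_of \<Union>D \<and> \<Union>D \<subseteq> I \<and> (\<Sum>k\<in>D. Sup k - Inf k) < \<delta> \<longrightarrow>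
        (\<Sum>k\<in>D. norm (f (Sup k) - f (Inf k))) < \<epsilon>)"

(* Solutions on [0,\<infinity>) of the differential inclusion x' \<in> F x; only the values of x on
   [0,\<infinity>) matter. *)
definition inclusion_solution ::
    "('a::euclidean_space \<Rightarrow> 'a set) \<Rightarrow> (real \<Rightarrow> 'a) \<Rightarrow> bool" where
  "inclusion_solution F x \<longleftrightarrow>
     (\<forall>T\<ge>0. absolutely_continuous_on {0..T} x) \<and>
     (AE t in lebesgue_on {0..}. \<exists>v\<in>F (x t). (x has_vector_derivative v) (at t within {0..}))"

definition origin_stable :: "('a::euclidean_space \<Rightarrow> 'a set) \<Rightarrow> bool" where
  "origin_stable F \<longleftrightarrow>
     (\<forall>\<epsilon>>0. \<exists>\<delta>>0. \<forall>x. inclusion_solution F x \<and> norm (x 0) < \<delta> \<longrightarrow> (\<forall>t\<ge>0. norm (x t) < \<epsilon>))"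

definition origin_globally_attractive :: "('a::euclidean_space \<Rightarrow> 'a set) \<Rightarrow> bool" where
  "origin_globally_attractive F \<longleftrightarrow> (\<forall>x. inclusion_solution F x \<longrightarrow> (x \<longlongrightarrow> 0) at_top)"

definition origin_globally_asymptotically_stable :: "('a::euclidean_space \<Rightarrow> 'a set) \<Rightarrow> bool" where
  "origin_globally_asymptotically_stable F \<longleftrightarrow> origin_stable F \<and> origin_globally_attractive F"

(* Filippov set-valued map of the closed loop \<sigma>' = B u, u = K \<sigma> / norm \<sigma>,
   whose right-hand side is discontinuous at \<sigma> = 0. *)
definition unit_vector_closed_loop :: "real^'m^'n \<Rightarrow> real^'n^'m \<Rightarrow> real^'n \<Rightarrow> (real^'n) set" where
  "unit_vector_closed_loop B K \<sigma> =
     (if \<sigma> = 0 then {(B ** K) *v v | v. norm v \<le> 1}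
      else {(B ** K) *v (\<sigma> /\<^sub>R norm \<sigma>)})"

end

theory Submission
  imports Defs
begin

text \<open>
  Put \<open>P = X\<^sup>-\<^sup>1\<close>; the quadratic form \<open>V \<sigma> = \<sigma> \<bullet> P \<sigma>\<close> is a Lyapunov function for every
  \<open>B\<close> in the hull.  Restricting the matrix inequality at a vertex to vectors whose second block
  vanishes leaves its upper left block, and discarding the positive term \<open>\<xi> \<bullet> R \<xi>\<close> gives
  \<open>\<xi> \<bullet> B\<^sub>i Z \<xi> \<le> - (\<mu> / 8) \<parallel>\<xi>\<parallel>\<^sup>2\<close>.  The left side is linear in the matrix, so the bound passes to the
  convex hull.  With \<open>\<xi> = P \<sigma>\<close> and \<open>K = Z P\<close>, the velocity at \<open>\<sigma> \<noteq> 0\<close> is \<open>B Z \<xi> / \<parallel>\<sigma>\<parallel>\<close>,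
  and since \<open>\<parallel>\<sigma>\<parallel>\<close> is at most a constant times \<open>\<parallel>\<xi>\<parallel>\<close> this yields
  \<open>\<sigma> \<bullet> P v \<le> - k \<parallel>\<sigma>\<parallel>\<close> for each admissible velocity \<open>v\<close>.  At the discontinuity
  \<open>\<sigma> = 0\<close> both sides are zero, whichever velocity the inclusion selects: the gradient of \<open>V\<close>
  vanishes there.

  What remains is to integrate \<open>V' \<le> - 2 k \<parallel>\<sigma>\<parallel>\<close> along solutions that are differentiable only
  almost everywhere.  This is \<open>absolutely_continuous_on_mean_value_le\<close>, where
  absolute continuity is what controls the exceptional null set.  Since \<open>V\<close> lies between
  multiples of \<open>\<parallel>\<sigma>\<parallel>\<^sup>2\<close>, monotonicity of \<open>V\<close> along solutions gives stability.  A solution on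
  which \<open>V\<close> stayed above a positive level would keep away from the origin, so \<open>V\<close> would decrease
  at a uniform linear rate and become negative; hence \<open>V\<close> gets below every positive level and, being
  monotone, tends to zero.
\<close>

section \<open>Absolutely continuous functions\<close>

lemma absolutely_continuous_on_subset:
  assumes "absolutely_continuous_on J f" and "I \<subseteq> J"
  shows "absolutely_continuous_on I f"
  using assms unfolding absolutely_continuous_on_def by (meson subset_trans)

lemma absolutely_continuous_on_lipschitz_compose:
  assumes f: "absolutely_continuous_on I f" and h: "L-lipschitz_on S h" and fS: "f ` I \<subseteq> S"
  shows "absolutely_continuous_on I (\<lambda>t. h (f t))"
  unfolding absolutely_continuous_on_def
proof (intro allI impI)
  fix e :: real
  assume "e > 0"
  have L0: "L \<ge> 0"
    using h by (rule lipschitz_on_nonneg)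
  have "e / (L + 1) > 0"
    using \<open>e > 0\<close> L0 by auto
  then obtain \<delta> where "\<delta> > 0" and \<delta>: "\<And>D. D division_of \<Union>D \<Longrightarrow> \<Union>D \<subseteq> I \<Longrightarrow> (\<Sum>k\<in>D. Sup k - Inf k) < \<delta>
      \<Longrightarrow> (\<Sum>k\<in>D. norm (f (Sup k) - f (Inf k))) < e / (L + 1)"
    using f unfolding absolutely_continuous_on_def by meson
  have "(\<Sum>k\<in>D. norm (h (f (Sup k)) - h (f (Inf k)))) < e"
    if D: "D division_of \<Union>D" "\<Union>D \<subseteq> I" "(\<Sum>k\<in>D. Sup k - Inf k) < \<delta>" for D
  proof -
    have "norm (h (f (Sup k)) - h (f (Inf k))) \<le> L * norm (f (Sup k) - f (Inf k))" if "k \<in> D" for k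
    proof -
      obtain u v where "k = {u..v}" "k \<noteq> {}" "k \<subseteq> I"
        using division_ofD(2-4)[OF D(1) \<open>k \<in> D\<close>] D(2) by (metis box_real(2) subset_trans)
      then have "Sup k \<in> I" "Inf k \<in> I"
        by auto
      then show ?thesis
        using lipschitz_onD[OF h, of "f (Sup k)" "f (Inf k)"] fS by (auto simp: dist_norm)
    qed
    then have "(\<Sum>k\<in>D. norm (h (f (Sup k)) - h (f (Inf k)))) \<le> L * (\<Sum>k\<in>D. norm (f (Sup k) - f (Inf k)))"
      by (simp add: sum_distrib_left sum_mono)
    also have "\<dots> \<le> L * (e / (L + 1))"
      using \<delta>[OF D] L0 by (intro mult_left_mono) auto
    also have "\<dots> < e"
      using L0 \<open>e > 0\<close> by (simp add: field_simps)
    finally show ?thesis .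
  qed
  then show "\<exists>\<delta>>0. \<forall>D. D division_of \<Union>D \<and> \<Union>D \<subseteq> I \<and> (\<Sum>k\<in>D. Sup k - Inf k) < \<delta> \<longrightarrow>
      (\<Sum>k\<in>D. norm (h (f (Sup k)) - h (f (Inf k)))) < e"
    using \<open>\<delta> > 0\<close> by blast
qed

lemma absolutely_continuous_on_imp_continuous_on:
  assumes f: "absolutely_continuous_on {a..b} f"
  shows "continuous_on {a..b} f"
proof -
  have "\<exists>d>0. \<forall>s\<in>{a..b}. dist s t < d \<longrightarrow> dist (f s) (f t) \<le> e" if "e > 0" and t: "t \<in> {a..b}" for t e
  proof -
    obtain \<delta> where "\<delta> > 0" and \<delta>: "\<And>D. D division_of \<Union>D \<Longrightarrow> \<Union>D \<subseteq> {a..b} \<Longrightarrow> (\<Sum>k\<in>D. Sup k - Inf k) < \<delta>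
        \<Longrightarrow> (\<Sum>k\<in>D. norm (f (Sup k) - f (Inf k))) < e"
      using f \<open>e > 0\<close> unfolding absolutely_continuous_on_def by meson
    have ordered: "dist (f u) (f v) \<le> e" if "u \<in> {a..b}" "v \<in> {a..b}" "u \<le> v" "v - u < \<delta>" for u v
    proof -
      have "{{u..v}} division_of \<Union>{{u..v}}"
        using division_of_self[of u v] that by (simp add: box_real)
      from \<delta>[OF this] that show ?thesis
        by (auto simp: dist_norm norm_minus_commute)
    qed
    have "dist (f s) (f t) \<le> e" if "s \<in> {a..b}" "dist s t < \<delta>" for s
      using ordered[of s t] ordered[of t s] that t by (cases "s \<le> t") (auto simp: dist_norm dist_commute norm_minus_commute)
    with \<open>\<delta> > 0\<close> show ?thesis by blast
  qed
  then show ?thesis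
    unfolding continuous_on_iff by (meson dense le_less_trans)
qed

text \<open>
  A gauge argument.  At a point outside \<open>N\<close> the derivative bounds the increment over every small
  interval around that point by its length times \<open>C + \<eta>\<close>.  Around points of \<open>N\<close> the gauge
  allows only intervals inside an open set of tiny measure, so by absolute continuity they contribute
  next to nothing.  By Cousin's lemma some tagged division is fine for this gauge, and summing the
  increments over it telescopes to \<open>g b - g a\<close>.
\<close>
lemma absolutely_continuous_on_mean_value_le:
  fixes g :: "real \<Rightarrow> real"
  assumes "a \<le> b" and ac: "absolutely_continuous_on {a..b} g" and N: "negligible N"
    and deriv: "\<And>t. t \<in> {a..b} - N \<Longrightarrow> \<exists>d\<le>C. (g has_real_derivative d) (at t within {a..b})"
  shows "g b - g a \<le> C * (b - a)"
proof (rule field_le_epsilon)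
  fix e :: real
  assume "e > 0"
  \<comment> \<open>The total error will be \<open>\<eta> (b - a)\<close> from the points of differentiability, and \<open>2 \<eta>\<close> from \<open>N\<close>.\<close>
  define \<eta> where "\<eta> = e / (b - a + 2)"
  have "\<eta> * (b - a + 2) = e"
    using \<open>a \<le> b\<close> by (simp add: \<eta>_def)
  then have "\<eta> * (b - a) + 2 * \<eta> = e"
    by (simp add: algebra_simps)
  moreover have "\<eta> > 0"
    using \<open>e > 0\<close> \<open>a \<le> b\<close> by (simp add: \<eta>_def)
  ultimately have \<eta>: "\<eta> > 0" "\<eta> * (b - a) + 2 * \<eta> = e"
    by auto
  obtain \<delta>0 where "\<delta>0 > 0" and \<delta>0: "\<And>D. D division_of \<Union>D \<Longrightarrow> \<Union>D \<subseteq> {a..b} \<Longrightarrow> (\<Sum>k\<in>D. Sup k - Inf k) < \<delta>0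
      \<Longrightarrow> (\<Sum>k\<in>D. norm (g (Sup k) - g (Inf k))) < \<eta>"
    using ac \<eta>(1) unfolding absolutely_continuous_on_def by meson
  \<comment> \<open>The second bound makes \<open>C + \<eta>\<close> times the total length of the intervals tagged in \<open>N\<close> negligible too.\<close>
  define \<delta> where "\<delta> = min \<delta>0 (\<eta> / (\<bar>C + \<eta>\<bar> + 1))"
  have "\<delta> > 0"
    using \<open>\<delta>0 > 0\<close> \<eta>(1) by (simp add: \<delta>_def)
  have C\<delta>: "\<bar>C + \<eta>\<bar> * \<delta> \<le> \<eta>"
  proof -
    have "\<bar>C + \<eta>\<bar> * \<delta> \<le> \<bar>C + \<eta>\<bar> * (\<eta> / (\<bar>C + \<eta>\<bar> + 1))"
      unfolding \<delta>_def by (intro mult_left_mono) auto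
    also have "\<dots> \<le> \<eta>"
      using \<eta>(1) by (simp add: field_simps)
    finally show ?thesis .
  qed
  obtain U where U: "open U" "N \<subseteq> U" "U \<in> lmeasurable" "measure lebesgue U < \<delta>"
  proof -
    have N': "N \<in> null_sets lebesgue"
      using N by (simp add: negligible_iff_null_sets)
    then obtain U where U: "open U" "N \<subseteq> U" "emeasure lebesgue (U - N) < ennreal \<delta>"
      using sets_lebesgue_outer_open[OF null_setsD2 \<open>\<delta> > 0\<close>] by metis
    have "emeasure lebesgue U = emeasure lebesgue (U - N)"
      using N' U(1) by (simp add: emeasure_Diff_null_set)
    with U have less: "emeasure lebesgue U < ennreal \<delta>"
      by simp
    then have fin: "U \<in> lmeasurable"
      using U(1) by (intro fmeasurableI) (auto simp: less_top[symmetric] top_unique)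
    then have "measure lebesgue U < \<delta>"
      using less \<open>\<delta> > 0\<close> by (simp add: emeasure_eq_measure2 ennreal_less_iff)
    with U fin show ?thesis
      using that by blast
  qed
  have "\<exists>r>0. \<forall>u v. u \<le> t \<and> t \<le> v \<and> {u..v} \<subseteq> {a..b} \<inter> ball t r \<longrightarrow> g v - g u \<le> (C + \<eta>) * (v - u)"
    if t: "t \<in> {a..b} - N" for t
  proof -
    obtain d where "d \<le> C" and "(g has_real_derivative d) (at t within {a..b})"
      using deriv[OF t] by blast
    then obtain r where "r > 0" and r: "\<And>y. y \<in> {a..b} \<Longrightarrow> norm (y - t) < r
        \<Longrightarrow> norm (g y - g t - d * (y - t)) \<le> \<eta> * norm (y - t)"
      using \<eta>(1) unfolding has_field_derivative_def has_derivative_within_alt by meson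
    have "g v - g u \<le> (C + \<eta>) * (v - u)"
      if uv: "u \<le> t" "t \<le> v" "{u..v} \<subseteq> {a..b} \<inter> ball t r" for u v
    proof -
      have "u \<in> {u..v}" "v \<in> {u..v}"
        using uv by auto
      then have "u \<in> {a..b} \<inter> ball t r" "v \<in> {a..b} \<inter> ball t r"
        using uv(3) by blast+
      then have "g v - g t \<le> (d + \<eta>) * (v - t)" "g t - g u \<le> (d + \<eta>) * (t - u)"
        using r[of v] r[of u] uv by (auto simp: dist_real_def algebra_simps)
      then have "g v - g u \<le> (d + \<eta>) * (v - u)"
        by (simp add: algebra_simps)
      also have "\<dots> \<le> (C + \<eta>) * (v - u)"
        using \<open>d \<le> C\<close> uv by (intro mult_right_mono) auto
      finally show ?thesis .
    qed
    with \<open>r > 0\<close> show ?thesis by blast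
  qed
  then obtain r where r0: "\<And>t. t \<in> {a..b} - N \<Longrightarrow> r t > 0"
    and r: "\<And>t u v. t \<in> {a..b} - N \<Longrightarrow> u \<le> t \<Longrightarrow> t \<le> v \<Longrightarrow> {u..v} \<subseteq> {a..b} \<inter> ball t (r t)
        \<Longrightarrow> g v - g u \<le> (C + \<eta>) * (v - u)"
    by metis
  define \<gamma> where "\<gamma> t = (if t \<in> N then U else if t \<in> {a..b} then ball t (r t) else UNIV)" for t
  have "gauge \<gamma>"
    unfolding gauge_def \<gamma>_def using U r0 by auto
  then obtain p where p: "p tagged_division_of {a..b}" "\<gamma> fine p"
    by (rule fine_division_exists_real)
  have interval: "\<exists>u v. K = {u..v} \<and> u \<le> t \<and> t \<le> v \<and> {u..v} \<subseteq> {a..b}" if "(t, K) \<in> p" for t K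
    using tagged_division_ofD(2-4)[OF p(1) that] by (auto simp: box_real)
  define bad where "bad = {(t, K) \<in> p. t \<in> N}"
  define D where "D = snd ` bad"
  have "bad \<subseteq> p" "finite p"
    using p(1) by (auto simp: bad_def)
  have bad_partial: "bad tagged_partial_division_of {a..b}"
    using tagged_partial_division_subset[OF _ \<open>bad \<subseteq> p\<close>] p(1) unfolding tagged_division_of_def by blast
  then have div: "D division_of \<Union>D"
    unfolding D_def by (rule partial_division_of_tagged_division)
  have bad_tagged: "bad tagged_division_of \<Union>D"
    unfolding D_def by (rule tagged_partial_division_of_Union_self[OF bad_partial])
  have D_sub: "\<Union>D \<subseteq> {a..b}"
    using interval \<open>bad \<subseteq> p\<close> unfolding D_def by fastforce
  have D_interval: "\<exists>u v. k = {u..v} \<and> u \<le> v" if "k \<in> D" for k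
    using that interval \<open>bad \<subseteq> p\<close> unfolding D_def by fastforce
  have D_U: "\<Union>D \<subseteq> U"
    using p(2) unfolding D_def bad_def fine_def \<gamma>_def by fastforce
  have small: "(\<Sum>k\<in>D. Sup k - Inf k) < \<delta>"
  proof -
    have "(\<Sum>k\<in>D. Sup k - Inf k) = (\<Sum>k\<in>D. measure lebesgue k)"
      using D_interval by (intro sum.cong) fastforce+
    also have "\<dots> = measure lebesgue (\<Union>D)"
      using content_division[OF div] .
    also have "\<dots> \<le> measure lebesgue U"
      using D_U U(3) lmeasurable_division[OF div] by (intro measure_mono_fmeasurable) auto
    finally show ?thesis
      using U(4) by simp
  qed
  \<comment> \<open>The excess of the increment of \<open>g\<close> over the slope \<open>C + \<eta>\<close>, which is positive only where the tag is in \<open>N\<close>.\<close>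
  define h where "h K = (g (Sup K) - g (Inf K)) - (C + \<eta>) * (Sup K - Inf K)" for K :: "real set"
  have "(\<Sum>(t,K)\<in>p. h K) \<le> (\<Sum>(t,K)\<in>bad. h K)"
  proof -
    have "h K \<le> 0" if "(t, K) \<in> p - bad" for t K
    proof -
      obtain u v where uv: "K = {u..v}" "u \<le> t" "t \<le> v" "{u..v} \<subseteq> {a..b}"
        using interval \<open>(t, K) \<in> p - bad\<close> by blast
      have t: "t \<in> {a..b} - N"
        using that uv by (auto simp: bad_def)
      then have "K \<subseteq> ball t (r t)"
        using p(2) that unfolding fine_def \<gamma>_def by fastforce
      then show ?thesis
        using r[OF t uv(2,3)] uv by (auto simp: h_def)
    qed
    then have "(\<Sum>(t,K)\<in>p - bad. h K) \<le> 0"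
      by (intro sum_nonpos) auto
    then show ?thesis
      using sum.subset_diff[OF \<open>bad \<subseteq> p\<close> \<open>finite p\<close>, of "\<lambda>(t,K). h K"] by linarith
  qed
  \<comment> \<open>Dropping the tags requires a summand that vanishes on every interval with empty interior,
    including \<open>{}\<close>, where \<open>Sup\<close> and \<open>Inf\<close> have no useful values.\<close>
  also have "(\<Sum>(t,K)\<in>bad. h K) = (\<Sum>(t,K)\<in>bad. if K = {} then 0 else h K)"
    using interval \<open>bad \<subseteq> p\<close> by (intro sum.cong) fastforce+
  also have "\<dots> = (\<Sum>K\<in>D. if K = {} then 0 else h K)"
    unfolding D_def
    by (rule sum.over_tagged_division_lemma[OF bad_tagged])
       (auto simp: h_def box_real box_eq_empty dest: order.antisym)
  also have "\<dots> = (\<Sum>K\<in>D. h K)"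
    using D_interval by (intro sum.cong) fastforce+
  also have "\<dots> \<le> (\<Sum>K\<in>D. norm (g (Sup K) - g (Inf K)) + \<bar>C + \<eta>\<bar> * (Sup K - Inf K))"
  proof (rule sum_mono)
    fix K
    assume "K \<in> D"
    then have "Sup K - Inf K \<ge> 0"
      using D_interval by fastforce
    then have "- (C + \<eta>) * (Sup K - Inf K) \<le> \<bar>C + \<eta>\<bar> * (Sup K - Inf K)"
      by (intro mult_right_mono) auto
    then show "h K \<le> norm (g (Sup K) - g (Inf K)) + \<bar>C + \<eta>\<bar> * (Sup K - Inf K)"
      unfolding h_def mult_minus_left real_norm_def by linarith
  qed
  also have "\<dots> = (\<Sum>K\<in>D. norm (g (Sup K) - g (Inf K))) + \<bar>C + \<eta>\<bar> * (\<Sum>K\<in>D. Sup K - Inf K)"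
    by (simp add: sum.distrib sum_distrib_left)
  also have "\<dots> \<le> \<eta> + \<bar>C + \<eta>\<bar> * \<delta>"
    using \<delta>0[OF div D_sub] small by (intro add_mono mult_left_mono) (auto simp: \<delta>_def)
  also have "\<dots> \<le> 2 * \<eta>"
    using C\<delta> by simp
  finally have "(\<Sum>(t,K)\<in>p. h K) \<le> 2 * \<eta>" .
  moreover have "(\<Sum>(t,K)\<in>p. h K) = (g b - g a) - (C + \<eta>) * (b - a)"
    using additive_tagged_division_1[OF \<open>a \<le> b\<close> p(1), of "\<lambda>t. g t - (C + \<eta>) * t"]
    by (simp add: h_def algebra_simps)
  ultimately show "g b - g a \<le> C * (b - a) + e"
    using \<eta>(2) by (simp add: algebra_simps)
qed

section \<open>Quadratic forms\<close>

lemma symmetric_matrix_inner: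
  fixes M :: "real^'n^'n"
  assumes "transpose M = M"
  shows "x \<bullet> (M *v y) = (M *v x) \<bullet> y"
  using assms by (metis dot_lmul_matrix transpose_matrix_vector)

text \<open>By homogeneity, \<open>c\<close> can be the minimum of the form on the compact unit sphere.\<close>
lemma pos_def_lower_bound:
  fixes M :: "real^'n^'n"
  assumes "pos_def M"
  obtains c where "c > 0" and "\<And>x. x \<bullet> (M *v x) \<ge> c * (norm x)\<^sup>2"
proof -
  have "continuous_on (sphere 0 1) (\<lambda>x. x \<bullet> (M *v x))"
    by (intro continuous_intros linear_continuous_on matrix_vector_mul_bounded_linear)
  moreover have "sphere (0::real^'n) 1 \<noteq> {}"
    by simp
  ultimately obtain z where z: "norm z = 1" "\<And>y. norm y = 1 \<Longrightarrow> z \<bullet> (M *v z) \<le> y \<bullet> (M *v y)"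
    using continuous_attains_inf[of "sphere 0 1" "\<lambda>x. x \<bullet> (M *v x)"] by auto
  have "x \<bullet> (M *v x) \<ge> (z \<bullet> (M *v z)) * (norm x)\<^sup>2" for x
  proof (cases "x = 0")
    case False
    have "x \<bullet> (M *v x) = ((x /\<^sub>R norm x) \<bullet> (M *v (x /\<^sub>R norm x))) * (norm x)\<^sup>2"
      using False by (simp add: matrix_vector_mult_scaleR power2_eq_square field_simps)
    also have "\<dots> \<ge> (z \<bullet> (M *v z)) * (norm x)\<^sup>2"
      using False by (intro mult_right_mono z(2)) auto
    finally show ?thesis .
  qed auto
  moreover have "z \<bullet> (M *v z) > 0"
    using assms z(1) unfolding pos_def_def by (metis norm_zero zero_neq_one)
  ultimately show ?thesis
    using that by blast
qed

lemma quadratic_form_upper_bound: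
  fixes M :: "real^'n^'n"
  shows "x \<bullet> (M *v x) \<le> onorm ((*v) M) * (norm x)\<^sup>2"
proof -
  have "x \<bullet> (M *v x) \<le> norm x * norm (M *v x)"
    by (rule norm_cauchy_schwarz)
  also have "\<dots> \<le> norm x * (onorm ((*v) M) * norm x)"
    by (intro mult_left_mono onorm) auto
  finally show ?thesis
    by (simp add: power2_eq_square mult_ac)
qed

text \<open>
  A quadratic form is only locally Lipschitz.  This suffices to make it absolutely continuous along
  a solution, which is bounded on compact time intervals.
\<close>
lemma quadratic_form_lipschitz_on_cball:
  fixes M :: "real^'n^'n"
  assumes "r \<ge> 0"
  shows "(2 * r * onorm ((*v) M))-lipschitz_on (cball 0 r) (\<lambda>x. x \<bullet> (M *v x))"
proof (rule lipschitz_onI)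
  let ?L = "onorm ((*v) M)"
  have L0: "?L \<ge> 0"
    by (rule onorm_pos_le) simp
  then show "0 \<le> 2 * r * ?L"
    using assms by simp
  fix x y :: "real^'n"
  assume xy: "x \<in> cball 0 r" "y \<in> cball 0 r"
  have bound: "\<bar>u \<bullet> (M *v w)\<bar> \<le> ?L * (norm u * norm w)" for u w
  proof -
    have "\<bar>u \<bullet> (M *v w)\<bar> \<le> norm u * norm (M *v w)"
      by (rule Cauchy_Schwarz_ineq2)
    also have "\<dots> \<le> norm u * (?L * norm w)"
      by (intro mult_left_mono onorm) auto
    finally show ?thesis by (simp add: mult_ac)
  qed
  have "x \<bullet> (M *v x) - y \<bullet> (M *v y) = x \<bullet> (M *v (x - y)) + (x - y) \<bullet> (M *v y)"
    by (simp add: matrix_vector_mult_diff_distrib inner_diff_left inner_diff_right)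
  then have "\<bar>x \<bullet> (M *v x) - y \<bullet> (M *v y)\<bar> \<le> ?L * (norm x * norm (x - y)) + ?L * (norm (x - y) * norm y)"
    using bound[of x "x - y"] bound[of "x - y" y] by linarith
  also have "\<dots> \<le> ?L * (r * norm (x - y)) + ?L * (norm (x - y) * r)"
    using xy L0 by (intro add_mono mult_left_mono mult_right_mono) auto
  finally show "dist (x \<bullet> (M *v x)) (y \<bullet> (M *v y)) \<le> 2 * r * ?L * dist x y"
    by (simp add: dist_norm algebra_simps)
qed

section \<open>Quadratic Lyapunov functions for differential inclusions\<close>

text \<open>
  The derivative of \<open>x t \<bullet> P (x t)\<close> is \<open>2 (x t \<bullet> P v)\<close> for the velocity \<open>v\<close>, by symmetry of
  \<open>P\<close>.  With \<open>\<rho> = 0\<close> the estimate says that the form is nonincreasing along solutions; with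
  \<open>\<rho> > 0\<close> it gives a uniform decay rate while the solution stays outside the ball of radius \<open>\<rho>\<close>.
\<close>
lemma quadratic_dissipation_along_solution:
  fixes P :: "real^'n^'n"
  assumes sym: "transpose P = P"
    and dissip: "\<And>\<sigma> v. v \<in> F \<sigma> \<Longrightarrow> \<sigma> \<bullet> (P *v v) \<le> - k * norm \<sigma>"
    and "k \<ge> 0" and sol: "inclusion_solution F x" and ab: "0 \<le> a" "a \<le> b"
    and away: "\<And>t. t \<in> {a..b} \<Longrightarrow> \<rho> \<le> norm (x t)"
  shows "x b \<bullet> (P *v x b) - x a \<bullet> (P *v x a) \<le> - (2 * k * \<rho>) * (b - a)"
proof -
  have ac: "absolutely_continuous_on {a..b} x"
    using sol ab unfolding inclusion_solution_def
    by (intro absolutely_continuous_on_subset[of "{0..b}" x "{a..b}"]) auto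
  have "bounded (x ` {a..b})"
    using absolutely_continuous_on_imp_continuous_on[OF ac] compact_continuous_image compact_imp_bounded
    by blast
  then obtain r where r: "r > 0" "\<And>t. t \<in> {a..b} \<Longrightarrow> norm (x t) \<le> r"
    unfolding bounded_pos by auto
  have acV: "absolutely_continuous_on {a..b} (\<lambda>t. x t \<bullet> (P *v x t))"
    using r by (intro absolutely_continuous_on_lipschitz_compose[OF ac quadratic_form_lipschitz_on_cball[of r P]]) auto
  have "AE t in lebesgue. t \<in> {0..} \<longrightarrow> (\<exists>v\<in>F (x t). (x has_vector_derivative v) (at t within {0..}))"
    using sol unfolding inclusion_solution_def by (subst (asm) AE_restrict_space_iff) auto
  then obtain N where "N \<in> null_sets lebesgue"
    and N_sub: "{t \<in> space lebesgue. \<not> (t \<in> {0..} \<longrightarrow>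
          (\<exists>v\<in>F (x t). (x has_vector_derivative v) (at t within {0..})))} \<subseteq> N"
    unfolding eventually_ae_filter by blast
  then have N: "negligible N"
    by (simp add: negligible_iff_null_sets)
  show ?thesis
  proof (rule absolutely_continuous_on_mean_value_le[OF ab(2) acV N])
    fix t
    assume t: "t \<in> {a..b} - N"
    then have "t \<in> {0..}" "t \<notin> N"
      using ab by auto
    then obtain v where v: "v \<in> F (x t)" and "(x has_vector_derivative v) (at t within {0..})"
      using N_sub by (auto simp: subset_iff)
    then have x': "(x has_vector_derivative v) (at t within {a..b})"
      using ab by (auto intro: has_vector_derivative_within_subset)
    have Px': "((\<lambda>t. P *v x t) has_vector_derivative P *v v) (at t within {a..b})"
      using bounded_linear.has_vector_derivative[OF matrix_vector_mul_bounded_linear x'] .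
    have "((\<lambda>t. x t \<bullet> (P *v x t)) has_vector_derivative x t \<bullet> (P *v v) + v \<bullet> (P *v x t)) (at t within {a..b})"
      using bounded_bilinear.has_vector_derivative[OF bounded_bilinear_inner x' Px'] .
    moreover have "v \<bullet> (P *v x t) = x t \<bullet> (P *v v)"
      using symmetric_matrix_inner[OF sym] by (simp add: inner_commute)
    ultimately have "((\<lambda>t. x t \<bullet> (P *v x t)) has_real_derivative 2 * (x t \<bullet> (P *v v))) (at t within {a..b})"
      by (simp add: has_real_derivative_iff_has_vector_derivative)
    moreover have "2 * (x t \<bullet> (P *v v)) \<le> - (2 * k * \<rho>)"
    proof -
      have "k * \<rho> \<le> k * norm (x t)"
        using t away \<open>k \<ge> 0\<close> by (intro mult_left_mono) auto
      then show ?thesis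
        using dissip[OF v] by (simp add: mult.commute)
    qed
    ultimately show "\<exists>d\<le>- (2 * k * \<rho>). ((\<lambda>t. x t \<bullet> (P *v x t)) has_real_derivative d) (at t within {a..b})"
      by blast
  qed
qed

text \<open>
  The dissipation hypothesis is of first degree in \<open>\<sigma>\<close>, as is natural for a right-hand side that is
  bounded but does not tend to zero at the origin.
\<close>
lemma quadratic_Lyapunov_function_imp_globally_asymptotically_stable:
  fixes P :: "real^'n^'n"
  assumes sym: "transpose P = P" and pos: "pos_def P" and "k > 0"
    and dissip: "\<And>\<sigma> v. v \<in> F \<sigma> \<Longrightarrow> \<sigma> \<bullet> (P *v v) \<le> - k * norm \<sigma>"
  shows "origin_globally_asymptotically_stable F"
proof -
  define V where "V \<sigma> = \<sigma> \<bullet> (P *v \<sigma>)" for \<sigma>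
  obtain c where "c > 0" and lower: "\<And>\<sigma>. V \<sigma> \<ge> c * (norm \<sigma>)\<^sup>2"
    using pos_def_lower_bound[OF pos] unfolding V_def by blast
  \<comment> \<open>The maximum with 1 only guarantees a positive constant to divide by.\<close>
  define C where "C = max 1 (onorm ((*v) P))"
  have "C > 0"
    by (simp add: C_def)
  have upper: "V \<sigma> \<le> C * (norm \<sigma>)\<^sup>2" for \<sigma>
  proof -
    have "onorm ((*v) P) * (norm \<sigma>)\<^sup>2 \<le> C * (norm \<sigma>)\<^sup>2"
      unfolding C_def by (intro mult_right_mono) auto
    then show ?thesis
      using quadratic_form_upper_bound[of \<sigma> P] unfolding V_def by linarith
  qed
  have decay: "V (x b) - V (x a) \<le> - (2 * k * \<rho>) * (b - a)"
    if "inclusion_solution F x" "0 \<le> a" "a \<le> b" "\<And>t. t \<in> {a..b} \<Longrightarrow> \<rho> \<le> norm (x t)" for x a b \<rho>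
    unfolding V_def
    using quadratic_dissipation_along_solution[OF sym dissip _ that] \<open>k > 0\<close> by simp
  have mono: "V (x b) \<le> V (x a)" if "inclusion_solution F x" "0 \<le> a" "a \<le> b" for x a b
    using decay[OF that, of 0] by simp
  have norm_less: "norm \<sigma> < e" if "V \<sigma> < c * e\<^sup>2" "e > 0" for \<sigma> e
  proof -
    have "c * (norm \<sigma>)\<^sup>2 < c * e\<^sup>2"
      using lower[of \<sigma>] that by linarith
    then show ?thesis
      using \<open>c > 0\<close> \<open>e > 0\<close> by (auto intro: power2_less_imp_less)
  qed
  have "origin_stable F"
    unfolding origin_stable_def
  proof (intro allI impI)
    fix e :: real
    assume "e > 0"
    have "norm (x t) < e"
      if sol: "inclusion_solution F x" and x0: "norm (x 0) < e * sqrt (c / C)" and "t \<ge> 0" for x t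
    proof (rule norm_less[OF _ \<open>e > 0\<close>])
      have "(norm (x 0))\<^sup>2 < (e * sqrt (c / C))\<^sup>2"
        using x0 by (intro power_strict_mono) auto
      also have "\<dots> = c * e\<^sup>2 / C"
        using \<open>c > 0\<close> \<open>C > 0\<close> by (simp add: power_mult_distrib)
      finally have "C * (norm (x 0))\<^sup>2 < c * e\<^sup>2"
        using \<open>C > 0\<close> by (simp add: field_simps)
      then show "V (x t) < c * e\<^sup>2"
        using mono[OF sol, of 0 t] upper[of "x 0"] \<open>t \<ge> 0\<close> by simp
    qed
    then show "\<exists>\<delta>>0. \<forall>x. inclusion_solution F x \<and> norm (x 0) < \<delta> \<longrightarrow> (\<forall>t\<ge>0. norm (x t) < e)"
      using \<open>e > 0\<close> \<open>c > 0\<close> \<open>C > 0\<close> by (intro exI[of _ "e * sqrt (c / C)"]) auto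
  qed
  moreover have "origin_globally_attractive F"
    unfolding origin_globally_attractive_def
  proof (intro allI impI)
    fix x
    assume sol: "inclusion_solution F x"
    have "\<exists>s\<ge>0. V (x s) < E" if "E > 0" for E
    proof (rule ccontr)
      assume "\<not> ?thesis"
      then have above: "E \<le> V (x s)" if "s \<ge> 0" for s
        using that by (meson not_less)
      define \<rho> where "\<rho> = sqrt (E / C)"
      have "\<rho> > 0"
        using \<open>E > 0\<close> \<open>C > 0\<close> by (simp add: \<rho>_def)
      have away: "\<rho> \<le> norm (x s)" if "s \<ge> 0" for s
        unfolding \<rho>_def using above[OF that] upper[of "x s"] \<open>C > 0\<close>
        by (intro real_le_lsqrt) (auto simp: field_simps)
      \<comment> \<open>The time at which the linear bound \<open>V (x 0) - 2 k \<rho> t\<close> reaches zero.\<close>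
      define T where "T = V (x 0) / (2 * k * \<rho>)"
      have "V (x 0) > 0"
        using above[of 0] \<open>E > 0\<close> by simp
      then have "T \<ge> 0" "2 * k * \<rho> * T = V (x 0)"
        using \<open>k > 0\<close> \<open>\<rho> > 0\<close> by (auto simp: T_def)
      then have "V (x T) \<le> 0"
        using decay[OF sol, of 0 T \<rho>] away by simp
      then show False
        using above[OF \<open>T \<ge> 0\<close>] \<open>E > 0\<close> by simp
    qed
    then have "\<forall>\<^sub>F t in at_top. norm (x t) < e" if "e > 0" for e
    proof -
      obtain s where "s \<ge> 0" "V (x s) < c * e\<^sup>2"
        using \<open>e > 0\<close> \<open>c > 0\<close> \<open>\<And>E. E > 0 \<Longrightarrow> \<exists>s\<ge>0. V (x s) < E\<close>[of "c * e\<^sup>2"] by auto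
      then have "norm (x t) < e" if "t \<ge> s" for t
        using mono[OF sol, of s t] that \<open>e > 0\<close> by (intro norm_less) auto
      then show ?thesis
        using eventually_at_top_linorder by blast
    qed
    then show "(x \<longlongrightarrow> 0) at_top"
      by (simp add: tendsto_iff)
  qed
  ultimately show ?thesis
    by (simp add: origin_globally_asymptotically_stable_def)
qed

section \<open>The linear matrix inequality\<close>

text \<open>The block matrix acts on \<open>(x, 0)\<close> through \<open>P\<close> alone.\<close>
lemma neg_def_upper_left_block:
  fixes P :: "real^'a^'a" and Q :: "real^'b^'a" and R :: "real^'a^'b" and S :: "real^'b^'b"
  assumes "neg_def (block_mat P Q R S)"
  shows "neg_def P"
  unfolding neg_def_def
proof (intro allI impI)
  fix x :: "real^'a"
  assume "x \<noteq> 0"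
  define z :: "real^('a + 'b)" where "z = (\<chi> i. case i of Inl a \<Rightarrow> x $ a | Inr b \<Rightarrow> 0)"
  have sum_UNIV: "(\<Sum>i\<in>(UNIV::('a + 'b) set). f i) = (\<Sum>a\<in>UNIV. f (Inl a)) + (\<Sum>b\<in>UNIV. f (Inr b))"
    for f :: "'a + 'b \<Rightarrow> real"
    by (simp add: UNIV_Plus_UNIV[symmetric] sum.Plus del: UNIV_Plus_UNIV)
  have "z \<bullet> (block_mat P Q R S *v z) = x \<bullet> (P *v x)"
    by (simp add: inner_vec_def matrix_vector_mult_def block_mat_def z_def sum_UNIV)
  moreover have "z \<noteq> 0"
  proof
    assume "z = 0"
    then have "z $ Inl a = 0" for a by simp
    then have "x = 0" by (simp add: z_def vec_eq_iff)
    with \<open>x \<noteq> 0\<close> show False by contradiction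
  qed
  ultimately show "x \<bullet> (P *v x) < 0"
    using assms unfolding neg_def_def by metis
qed

lemma pos_def_matrix_inv:
  fixes X :: "real^'n^'n"
  assumes pos: "pos_def X"
  shows "X ** matrix_inv X = mat 1" and "matrix_inv X ** X = mat 1"
proof -
  have "x = 0" if "X *v x = 0" for x
    using pos that unfolding pos_def_def by (metis inner_zero_right less_irrefl)
  then have "invertible X"
    using matrix_left_invertible_ker invertible_left_inverse by metis
  then have "\<exists>Y. X ** Y = mat 1 \<and> Y ** X = mat 1"
    by (simp add: invertible_def)
  then show "X ** matrix_inv X = mat 1" and "matrix_inv X ** X = mat 1"
    unfolding matrix_inv_def by (metis (mono_tags, lifting) someI_ex)+
qed

text \<open>
  For each \<open>\<xi>\<close> the constraint is a half-space in the space of matrices \<open>B\<close>.  This carries the bound from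
  the vertices to their convex hull.
\<close>
lemma convex_bilinear_form_bound:
  fixes Z :: "real^'n^'m"
  shows "convex {B :: real^'m^'n. \<forall>\<xi>. \<xi> \<bullet> (B *v (Z *v \<xi>)) \<le> q \<xi>}"
proof (rule convexI)
  fix A B :: "real^'m^'n" and u v :: real
  assume AB: "A \<in> {B. \<forall>\<xi>. \<xi> \<bullet> (B *v (Z *v \<xi>)) \<le> q \<xi>}" "B \<in> {B. \<forall>\<xi>. \<xi> \<bullet> (B *v (Z *v \<xi>)) \<le> q \<xi>}"
    and uv: "0 \<le> u" "0 \<le> v" "u + v = 1"
  have "\<xi> \<bullet> ((u *\<^sub>R A + v *\<^sub>R B) *v (Z *v \<xi>)) \<le> q \<xi>" for \<xi>
  proof -
    have "\<xi> \<bullet> ((u *\<^sub>R A + v *\<^sub>R B) *v (Z *v \<xi>)) = u * (\<xi> \<bullet> (A *v (Z *v \<xi>))) + v * (\<xi> \<bullet> (B *v (Z *v \<xi>)))"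
      by (simp add: matrix_vector_mult_add_rdistrib scaleR_matrix_vector_assoc[symmetric] inner_add_right)
    also have "\<dots> \<le> q \<xi>"
      using AB uv by (intro convex_bound_le) auto
    finally show ?thesis .
  qed
  then show "u *\<^sub>R A + v *\<^sub>R B \<in> {B. \<forall>\<xi>. \<xi> \<bullet> (B *v (Z *v \<xi>)) \<le> q \<xi>}"
    by simp
qed

section \<open>Global asymptotic stability of the closed loop\<close>

theorem theorem2:
  fixes N :: nat
    and Bs :: "nat \<Rightarrow> real^'m^'n"
    and \<mu> :: real
    and X R :: "real^'n^'n"
    and Z :: "real^'n^'m"
    and K :: "real^'n^'m"
  assumes "\<mu> > 0"
    and "transpose X = X" and "transpose R = R"
    and "pos_def X" and "pos_def R"
    and "\<forall>i\<in>{1..N}. neg_def (block_mat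
           (Bs i ** Z + transpose Z ** transpose (Bs i) + (\<mu> / 4) *\<^sub>R mat 1 + R)
           (transpose Z ** transpose (Bs i))
           (Bs i ** Z)
           (- (\<mu> *\<^sub>R mat 1)))"
    and "K = Z ** matrix_inv X"
  shows "\<forall>B\<in>convex hull (Bs ` {1..N}).
           origin_globally_asymptotically_stable (unit_vector_closed_loop B K)"
proof
  fix B
  assume B: "B \<in> convex hull (Bs ` {1..N})"
  define P where "P = matrix_inv X"
  have XP: "X ** P = mat 1" and PX: "P ** X = mat 1"
    unfolding P_def using pos_def_matrix_inv[OF \<open>pos_def X\<close>] by auto
  have XP_id: "X *v (P *v \<sigma>) = \<sigma>" for \<sigma>
    by (simp add: matrix_vector_mul_assoc XP)
  have symP: "transpose P = P"
    by (metis XP PX \<open>transpose X = X\<close> matrix_mul_assoc matrix_mul_lid matrix_mul_rid matrix_transpose_mul transpose_mat)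
  have posP: "pos_def P"
    unfolding pos_def_def
  proof (intro allI impI)
    fix \<sigma> :: "real^'n"
    assume "\<sigma> \<noteq> 0"
    then have "P *v \<sigma> \<noteq> 0"
      using XP_id[of \<sigma>] by auto
    then have "(P *v \<sigma>) \<bullet> (X *v (P *v \<sigma>)) > 0"
      using \<open>pos_def X\<close> unfolding pos_def_def by blast
    then show "\<sigma> \<bullet> (P *v \<sigma>) > 0"
      by (simp add: XP_id inner_commute)
  qed
  have vertex: "\<xi> \<bullet> (Bs i *v (Z *v \<xi>)) \<le> - (\<mu> / 8) * (norm \<xi>)\<^sup>2" if "i \<in> {1..N}" for i \<xi>
  proof (cases "\<xi> = 0")
    case False
    let ?M = "Bs i ** Z"
    have "neg_def (?M + transpose Z ** transpose (Bs i) + (\<mu> / 4) *\<^sub>R mat 1 + R)"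
      using assms(6) that neg_def_upper_left_block by blast
    then have "\<xi> \<bullet> ((?M + transpose ?M + (\<mu> / 4) *\<^sub>R mat 1 + R) *v \<xi>) < 0"
      using False by (simp add: neg_def_def matrix_transpose_mul)
    then have "\<xi> \<bullet> (?M *v \<xi>) + \<xi> \<bullet> (transpose ?M *v \<xi>) + (\<mu> / 4) * (norm \<xi>)\<^sup>2 + \<xi> \<bullet> (R *v \<xi>) < 0"
      by (simp add: matrix_vector_mult_add_rdistrib scaleR_matrix_vector_assoc[symmetric]
          inner_add_right power2_norm_eq_inner del: transpose_matrix_vector)
    moreover have "\<xi> \<bullet> (transpose ?M *v \<xi>) = \<xi> \<bullet> (?M *v \<xi>)"
      by (metis dot_lmul_matrix inner_commute transpose_matrix_vector)
    moreover have "\<xi> \<bullet> (R *v \<xi>) > 0"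
      using \<open>pos_def R\<close> False by (simp add: pos_def_def)
    ultimately show ?thesis
      by (simp add: matrix_vector_mul_assoc)
  qed auto
  have "convex hull (Bs ` {1..N}) \<subseteq> {B. \<forall>\<xi>. \<xi> \<bullet> (B *v (Z *v \<xi>)) \<le> - (\<mu> / 8) * (norm \<xi>)\<^sup>2}"
    using vertex by (intro hull_minimal convex_bilinear_form_bound) auto
  then have hull: "\<xi> \<bullet> (B *v (Z *v \<xi>)) \<le> - (\<mu> / 8) * (norm \<xi>)\<^sup>2" for \<xi>
    using B by blast
  define b where "b = max 1 (onorm ((*v) X))"
  have "b > 0"
    by (simp add: b_def)
  have norm_le: "norm \<sigma> \<le> b * norm (P *v \<sigma>)" for \<sigma>
  proof -
    have "norm \<sigma> \<le> onorm ((*v) X) * norm (P *v \<sigma>)"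
      using onorm[of "(*v) X" "P *v \<sigma>"] by (simp add: XP_id)
    also have "\<dots> \<le> b * norm (P *v \<sigma>)"
      unfolding b_def by (intro mult_right_mono) auto
    finally show ?thesis .
  qed
  define k where "k = \<mu> / (8 * b\<^sup>2)"
  have "k > 0"
    using \<open>\<mu> > 0\<close> \<open>b > 0\<close> by (simp add: k_def)
  have dissip: "\<sigma> \<bullet> (P *v v) \<le> - k * norm \<sigma>" if v: "v \<in> unit_vector_closed_loop B K \<sigma>" for \<sigma> v
  proof (cases "\<sigma> = 0")
    case False
    define \<xi> where "\<xi> = P *v \<sigma>"
    have "v = (B *v (Z *v \<xi>)) /\<^sub>R norm \<sigma>"
      using v False \<open>K = Z ** matrix_inv X\<close>
      by (simp add: unit_vector_closed_loop_def matrix_vector_mul_assoc[symmetric] matrix_vector_mult_scaleR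
          \<xi>_def P_def)
    then have "\<sigma> \<bullet> (P *v v) = (\<xi> \<bullet> (B *v (Z *v \<xi>))) / norm \<sigma>"
      using symmetric_matrix_inner[OF symP, of \<sigma> v] by (simp add: \<xi>_def divide_inverse mult.commute)
    also have "\<dots> \<le> (- k * (norm \<sigma>)\<^sup>2) / norm \<sigma>"
    proof (rule divide_right_mono)
      have "(norm \<sigma>)\<^sup>2 \<le> b\<^sup>2 * (norm \<xi>)\<^sup>2"
        using power_mono[OF norm_le[of \<sigma>], of 2] by (simp add: \<xi>_def power_mult_distrib)
      then have "k * (norm \<sigma>)\<^sup>2 \<le> k * (b\<^sup>2 * (norm \<xi>)\<^sup>2)"
        using \<open>k > 0\<close> by simp
      also have "\<dots> = (\<mu> / 8) * (norm \<xi>)\<^sup>2"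
        using \<open>b > 0\<close> by (simp add: k_def)
      finally show "\<xi> \<bullet> (B *v (Z *v \<xi>)) \<le> - k * (norm \<sigma>)\<^sup>2"
        using hull[of \<xi>] by simp
    qed simp
    finally show ?thesis
      using False by (simp add: power2_eq_square)
  qed simp
  show "origin_globally_asymptotically_stable (unit_vector_closed_loop B K)"
    by (rule quadratic_Lyapunov_function_imp_globally_asymptotically_stable[OF symP posP \<open>k > 0\<close> dissip])
qed

end
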